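(* Let $\mathcal{X}$ and $\mathcal{Y}$ be discrete alphabets and let $P_{Y|X}$ be a fixed channel from $\mathcal{X}$ to $\mathcal{Y}$. For every input distribution $P_X$ on $\mathcal{X}$, the symmetrized KL information satisfies $$I_{\mathrm{SKL}}(X;Y)=\sum_{x\in\mathcal{X}}\sum_{\tilde{x}\in\mathcal{X}} P_X(x)\,P_X(\tilde{x})\,D\left(P_{Y|X=x}\,\|\,P_{Y|X=\tilde{x}}\right).$$
   Context: A discrete alphabet is a nonempty finite or countable set. A channel $P_{Y|X}$ from $\mathcal{X}$ to $\mathcal{Y}$ assigns to each $x\in\mathcal{X}$ a probability distribution $P_{Y|X=x}$ on $\mathcal{Y}$. Given an input distribution $P_X$ on $\mathcal{X}$, the joint distribution is $P_{XY}(x,y)=P_X(x)P_{Y|X}(y|x)$, the output marginal is $P_Y(y)=\sum_{x}P_X(x)P_{Y|X}(y|x)$, and $P_XP_Y$ denotes the product distribution $(x,y)\mapsto P_X(x)P_Y(y)$. The Kullback-Leibler divergence between probability distributions $P,Q$ on a discrete set is $D(P\|Q)=\sum_{z} P(z)\log\frac{P(z)}{Q(z)}$, with the convention $0\log\frac{0}{q}=0$, and $D(P\|Q)=+\infty$ if $P$ is not absolutely continuous with respect to $Q$. The mutual information is $I(X;Y)=D(P_{XY}\|P_XP_Y)$, the Lautum information is $L(X;Y)=D(P_XP_Y\|P_{XY})$, and the symmetrized KL information is $I_{\mathrm{SKL}}(X;Y)=I(X;Y)+L(X;Y)$. All these quantities take values in $[0,+\infty]$, and in sums the convention $0\cdot(+\infty)=0$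 is used. *)

theory Defs
  imports "HOL-Probability.Probability"
begin

(* Discrete distributions are 'a pmf; a channel from 'x to 'y is a function 'x \<Rightarrow> 'y pmf. *)

definition joint_pmf :: "'x pmf \<Rightarrow> ('x \<Rightarrow> 'y pmf) \<Rightarrow> ('x \<times> 'y) pmf" where
  "joint_pmf P W = bind_pmf P (\<lambda>x. map_pmf (Pair x) (W x))"

definition output_pmf :: "'x pmf \<Rightarrow> ('x \<Rightarrow> 'y pmf) \<Rightarrow> 'y pmf" where
  "output_pmf P W = bind_pmf P W"

lemma pmf_joint_pmf: "pmf (joint_pmf P W) (x, y) = pmf P x * pmf (W x) y"
proof -
  have "pmf (map_pmf (Pair x') (W x')) (x, y) = indicator {x} x' * pmf (W x) y" for x'
  proof (cases "x' = x")
    case True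
    then show ?thesis
      by (simp add: pmf_map_inj' inj_on_def)
  next
    case False
    then show ?thesis
      by (auto simp: pmf_eq_0_set_pmf)
  qed
  then show ?thesis
    by (simp add: joint_pmf_def pmf_bind measure_pmf_single)
qed

lemma pmf_output_pmf: "pmf (output_pmf P W) y = (\<Sum>\<^sub>\<infinity>x. pmf P x * pmf (W x) y)"
proof -
  have "Infinite_Set_Sum.abs_summable_on (\<lambda>x. pmf P x * pmf (W x) y) UNIV"
    by (rule abs_summable_on_comparison_test'[OF pmf_abs_summable[of P]])
       (simp add: mult_left_le pmf_le_1)
  then show ?thesis
    by (simp add: output_pmf_def pmf_bind infsetsum_infsum pmf_expectation_eq_infsetsum)
qed

text \<open>
  The library's \<open>KL_divergence\<close> is real-valued and is 0 when the divergence is infinite, so the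
  divergence is defined here with values in the extended reals. The sum is the unordered sum of
  extended reals; it always exists (\<open>kl_div_summable\<close>), so the default value of \<open>infsum\<close> for
  nonsummable families never occurs. Terms with \<open>pmf P z = 0\<close> are 0.
\<close>

definition kl_div :: "real \<Rightarrow> 'a pmf \<Rightarrow> 'a pmf \<Rightarrow> ereal" where
  "kl_div b P Q =
    (if \<forall>z. pmf Q z = 0 \<longrightarrow> pmf P z = 0
     then (\<Sum>\<^sub>\<infinity>z. ereal (pmf P z * log b (pmf P z / pmf Q z)))
     else \<infinity>)"

lemma kl_div_summable_nonneg:
  assumes b: "b > 1" and ac: "\<forall>z. pmf Q z = 0 \<longrightarrow> pmf P z = 0"
  defines "f \<equiv> \<lambda>z. ereal (pmf P z * log b (pmf P z / pmf Q z))"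
  shows kl_div_summable: "f summable_on UNIV"
    and kl_div_sum_nonneg: "infsum f UNIV \<ge> 0"
proof -
  define h where "h z = (pmf P z - pmf Q z) / ln b" for z
  define g where "g z = ereal (pmf P z * log b (pmf P z / pmf Q z) - h z)" for z
  have lnb: "ln b > 0"
    using b by simp
  have g: "g z \<ge> 0" for z
  proof (cases "pmf P z = 0")
    case True
    then show ?thesis
      using lnb by (simp add: g_def h_def)
  next
    case False
    then have p: "pmf P z > 0" and q: "pmf Q z > 0"
      using ac by (auto simp: less_le)
    have "ln (pmf Q z / pmf P z) \<le> pmf Q z / pmf P z - 1"
      using p q by (intro ln_le_minus_one) simp
    then have "pmf P z * (ln (pmf Q z) - ln (pmf P z)) \<le> pmf P z * (pmf Q z / pmf P z - 1)"
      using p q by (intro mult_left_mono) (simp_all add: ln_div)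
    then have "pmf P z - pmf Q z \<le> pmf P z * ln (pmf P z / pmf Q z)"
      using p q by (simp add: ln_div algebra_simps)
    then show ?thesis
      using lnb by (simp add: g_def h_def log_def divide_right_mono)
  qed
  have has_sum_pmf: "(pmf R has_sum 1) UNIV" for R :: "'a pmf"
    using pmf_abs_summable[of R UNIV] infsetsum_pmf_eq_1[of R UNIV]
    by (metis abs_summable_equivalent has_sum_infsum abs_summable_summable infsetsum_infsum subset_UNIV)
  have "((\<lambda>z. (pmf P z + - pmf Q z) * (1 / ln b)) has_sum (1 + - 1) * (1 / ln b)) UNIV"
    by (intro has_sum_cmult_left has_sum_add has_sum_uminusI has_sum_pmf)
  then have h: "(h has_sum 0) UNIV"
    by (simp add: h_def[abs_def])
  have gs: "(g has_sum infsum g UNIV) UNIV"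
    by (intro has_sum_infsum nonneg_summable_on_complete g)
  have "((\<lambda>F. sum g F + ereal (sum h F)) \<longlongrightarrow> infsum g UNIV + ereal 0) (finite_subsets_at_top UNIV)"
    using gs h unfolding has_sum_def
    by (intro tendsto_add_ereal_general1) (auto simp: tendsto_ereal)
  moreover have "sum g F + ereal (sum h F) = sum f F" for F
    by (simp add: g_def f_def sum_subtractf)
  ultimately have "(f has_sum infsum g UNIV) UNIV"
    by (simp add: has_sum_def zero_ereal_def[symmetric])
  then show "f summable_on UNIV" "infsum f UNIV \<ge> 0"
    using g by (auto simp: summable_on_def infsumI intro!: infsum_nonneg)
qed

definition mutual_info :: "real \<Rightarrow> 'x pmf \<Rightarrow> ('x \<Rightarrow> 'y pmf) \<Rightarrow> ereal" where
  "mutual_info b P W = kl_div b (joint_pmf P W) (pair_pmf P (output_pmf P W))"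

definition lautum_info :: "real \<Rightarrow> 'x pmf \<Rightarrow> ('x \<Rightarrow> 'y pmf) \<Rightarrow> ereal" where
  "lautum_info b P W = kl_div b (pair_pmf P (output_pmf P W)) (joint_pmf P W)"

definition skl_info :: "real \<Rightarrow> 'x pmf \<Rightarrow> ('x \<Rightarrow> 'y pmf) \<Rightarrow> ereal" where
  "skl_info b P W = mutual_info b P W + lautum_info b P W"

end

theory Submission
  imports Defs
begin

text \<open>
  Adding the summable family \<open>Q z - P z\<close>, whose sum is 0, to the terms of the divergence makes them
  nonnegative, so that \<open>D(P \<parallel> Q)\<close> becomes an integral of a nonnegative function \<open>\<phi> (P z) (Q z)\<close>
  and Tonelli's theorem applies. Write \<open>w\<^sub>x\<close> for the output probability of a fixed letter \<open>y\<close> given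
  \<open>x\<close> and \<open>q\<close> for its mean under the input distribution. The compensation identity
  \<open>E[\<phi> w\<^sub>x c] = E[\<phi> w\<^sub>x q] + \<phi> q c\<close>, averaged over \<open>c = w\<^sub>x\<^sub>'\<close> and summed over \<open>y\<close>, is the claim,
  because \<open>\<phi>\<close> is homogeneous. Both sides may be infinite.
\<close>

text \<open>Bridge between unordered sums and integrals, where Tonelli's theorem is available.
  Countability exhausts the type by the finite sets \<open>A n\<close>, so monotone convergence
  makes the integral a supremum of finite partial sums, which is also what a nonnegative unordered
  sum is.\<close>

lemma has_sum_nn_integral_count_space:
  fixes f :: "'a::countable \<Rightarrow> ennreal"
  shows "(f has_sum (\<integral>\<^sup>+x. f x \<partial>count_space UNIV)) UNIV"
proof -
  define A where "A n = {x::'a. to_nat x < n}" for n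
  have fin: "finite (A n)" for n
    unfolding A_def
    by (rule finite_imageD[of to_nat])
       (auto intro: finite_subset[of _ "{..<n}"] inj_on_subset[OF inj_to_nat])
  have nn_A: "(\<integral>\<^sup>+x. f x * indicator F x \<partial>count_space UNIV) = sum f F" if "finite F" for F
    using that by (simp add: nn_integral_count_space_indicator[symmetric] nn_integral_count_space_finite)
  have "f x = (SUP n. f x * indicator (A n) x)" for x
  proof (rule antisym)
    show "f x \<le> (SUP n. f x * indicator (A n) x)"
      by (rule SUP_upper2[of "Suc (to_nat x)"]) (auto simp: A_def)
  qed (auto intro!: SUP_least split: split_indicator)
  then have "(\<integral>\<^sup>+x. f x \<partial>count_space UNIV) = (\<integral>\<^sup>+x. (SUP n. f x * indicator (A n) x) \<partial>count_space UNIV)"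
    by simp
  also have "\<dots> = (SUP n. \<integral>\<^sup>+x. f x * indicator (A n) x \<partial>count_space UNIV)"
    by (intro nn_integral_monotone_convergence_SUP)
       (auto simp: incseq_def le_fun_def A_def split: split_indicator)
  also have "\<dots> = (SUP n. sum f (A n))"
    by (simp add: nn_A fin)
  finally have eq: "(\<integral>\<^sup>+x. f x \<partial>count_space UNIV) = (SUP n. sum f (A n))" .
  have "(SUP n. sum f (A n)) = (SUP F\<in>{F. finite F \<and> F \<subseteq> UNIV}. sum f F)"
  proof (rule antisym)
    show "(SUP F\<in>{F. finite F \<and> F \<subseteq> UNIV}. sum f F) \<le> (SUP n. sum f (A n))"
      \<comment> \<open>Back in integral form, the bound is clear: a sum over a finite
        \<open>F\<close> is the integral of \<open>f\<close> cut off outside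
        \<open>F\<close>.\<close>
      unfolding eq[symmetric]
      by (auto intro!: SUP_least nn_integral_mono simp: nn_A[symmetric] split: split_indicator)
  qed (use fin in \<open>auto intro!: SUP_least SUP_upper\<close>)
  then have "(\<integral>\<^sup>+x. f x \<partial>count_space UNIV) = infsum f UNIV"
    by (simp only: eq nonneg_infsum_complete zero_le)
  then show ?thesis
    by (simp only: has_sum_infsum nonneg_summable_on_complete zero_le)
qed

text \<open>\<open>enn2ereal\<close> is additive and continuous, so it passes through finite sums
  and their limit.\<close>

lemma has_sum_enn2ereal:
  fixes f :: "'a::countable \<Rightarrow> ennreal"
  shows "((\<lambda>x. enn2ereal (f x)) has_sum enn2ereal (\<integral>\<^sup>+x. f x \<partial>count_space UNIV)) UNIV"
proof -
  have "((enn2ereal \<circ> f) has_sum enn2ereal (\<integral>\<^sup>+x. f x \<partial>count_space UNIV)) UNIV"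
    by (rule has_sum_comm_additive_general)
       (auto intro: has_sum_nn_integral_count_space
          simp: continuous_at_enn2ereal[unfolded isCont_def] sum_enn2ereal)
  then show ?thesis
    by (simp add: o_def)
qed

lemmas infsum_enn2ereal = has_sum_enn2ereal[THEN infsumI]

text \<open>This is the \<open>\<phi>\<close> of the overview. The infinite branch encodes absolute
  continuity pointwise: with \<open>r / 0 = 0\<close> and \<open>ln 0 = 0\<close>, the other branch
  would give a negative real for \<open>r > 0\<close>, which \<open>ennreal\<close> truncates to
  0.\<close>

definition kl_integrand :: "real \<Rightarrow> real \<Rightarrow> real \<Rightarrow> ennreal" where
  "kl_integrand b r s =
    (if s = 0 \<and> r \<noteq> 0 then \<infinity> else ennreal (r * log b (r / s) - (r - s) / ln b))"

text \<open>Rests on \<open>ln t \<le> t - 1\<close> at \<open>t = s / r\<close>. It guarantees that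
  \<open>ennreal\<close> truncates nothing in the finite branch of
  \<open>kl_integrand\<close>.\<close>

lemma kl_integrand_nonneg:
  assumes b: "b > 1" and "r \<ge> 0" "s \<ge> 0" and ac: "s = 0 \<longrightarrow> r = 0"
  shows "r * log b (r / s) - (r - s) / ln b \<ge> 0"
proof (cases "r = 0")
  case True
  then show ?thesis
    using assms by simp
next
  case False
  then have r: "r > 0" and s: "s > 0"
    using assms by auto
  have "ln (s / r) \<le> s / r - 1"
    using r s by (intro ln_le_minus_one) simp
  then have "r * ln (s / r) \<le> r * (s / r - 1)"
    using r by (intro mult_left_mono) simp_all
  then have "r - s \<le> r * ln (r / s)"
    using r s by (simp add: ln_div algebra_simps)
  then have "(r - s) / ln b \<le> r * ln (r / s) / ln b"
    using b by (intro divide_right_mono) simp_all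
  then show ?thesis
    by (simp add: log_def)
qed

text \<open>The factor cancels inside the logarithm; \<open>c = 0\<close> is covered because 0 times
  infinity is 0 in \<open>ennreal\<close>.\<close>

lemma kl_integrand_cmult:
  assumes "c \<ge> 0"
  shows "kl_integrand b (c * r) (c * s) = ennreal c * kl_integrand b r s"
proof (cases "c = 0")
  case False
  then have "c * r * log b (c * r / (c * s)) - (c * r - c * s) / ln b =
      c * (r * log b (r / s) - (r - s) / ln b)"
    by (simp add: algebra_simps diff_divide_distrib)
  then show ?thesis
    using False assms by (auto simp: kl_integrand_def ennreal_mult' ennreal_mult_top)
qed (simp add: kl_integrand_def)

lemma kl_div_eq_nn_integral:
  fixes P Q :: "'a::countable pmf"
  assumes b: "b > 1"
  shows "kl_div b P Q =
    enn2ereal (\<integral>\<^sup>+z. kl_integrand b (pmf P z) (pmf Q z) \<partial>count_space UNIV)"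
proof (cases "\<forall>z. pmf Q z = 0 \<longrightarrow> pmf P z = 0")
  case True
  define f where "f z = ereal (pmf P z * log b (pmf P z / pmf Q z))" for z
  define h where "h z = (pmf P z - pmf Q z) / ln b" for z
  have has_sum_pmf: "(pmf R has_sum 1) UNIV" for R :: "'a pmf"
    using pmf_abs_summable[of R UNIV] infsetsum_pmf_eq_1[of R UNIV]
    by (metis abs_summable_equivalent has_sum_infsum abs_summable_summable infsetsum_infsum subset_UNIV)
  have "((\<lambda>z. (pmf Q z + - pmf P z) * (1 / ln b)) has_sum (1 + - 1) * (1 / ln b)) UNIV"
    by (intro has_sum_cmult_left has_sum_add has_sum_uminusI has_sum_pmf)
  then have h: "((\<lambda>z. - h z) has_sum 0) UNIV"
    by (simp add: h_def diff_divide_distrib)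
  have "(f has_sum kl_div b P Q) UNIV"
    using kl_div_summable[OF b True] True by (simp add: kl_div_def f_def[abs_def])
  \<comment> \<open>The limit of \<open>f\<close> may be infinite, but the limit added to it is the
    finite 0, so the extended real limits add.\<close>
  then have "((\<lambda>F. sum f F + ereal (\<Sum>z\<in>F. - h z)) \<longlongrightarrow> kl_div b P Q + ereal 0)
      (finite_subsets_at_top UNIV)"
    using h unfolding has_sum_def
    by (intro tendsto_add_ereal_general1) (auto simp: tendsto_ereal)
  moreover have "enn2ereal (kl_integrand b (pmf P z) (pmf Q z)) = f z + ereal (- h z)" for z
    using kl_integrand_nonneg[OF b, of "pmf P z" "pmf Q z"] True
    by (auto simp: kl_integrand_def f_def h_def)
  then have "sum (\<lambda>z. enn2ereal (kl_integrand b (pmf P z) (pmf Q z))) =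
      (\<lambda>F. sum f F + ereal (\<Sum>z\<in>F. - h z))"
    by (simp add: fun_eq_iff sum.distrib del: sum_enn2ereal)
  ultimately have "((\<lambda>z. enn2ereal (kl_integrand b (pmf P z) (pmf Q z))) has_sum kl_div b P Q) UNIV"
    by (simp only: has_sum_def zero_ereal_def[symmetric] add_0_right)
  from infsumI[OF this] show ?thesis
    by (simp only: infsum_enn2ereal)
next
  case False
  then obtain z where "pmf Q z = 0" "pmf P z \<noteq> 0"
    by blast
  \<comment> \<open>Under counting measure a single point of infinite value makes the integral
    infinite.\<close>
  then have "(\<integral>\<^sup>+z. kl_integrand b (pmf P z) (pmf Q z) \<partial>count_space UNIV) = \<infinity>"
    using nn_integral_ge_point[of z UNIV "\<lambda>z. kl_integrand b (pmf P z) (pmf Q z)"]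
    by (simp add: kl_integrand_def top_unique)
  then show ?thesis
    using False by (auto simp: kl_div_def)
qed

text \<open>For positive \<open>q\<close> and \<open>c\<close>, the integrands with second argument
  \<open>c\<close> and \<open>q\<close> differ by an expression affine in \<open>a x\<close>. Its
  mean is therefore its value at the mean \<open>q\<close>, namely the finite form of
  \<open>kl_integrand b q c\<close>. The bound \<open>B\<close> makes \<open>a\<close>
  integrable.\<close>

lemma nn_integral_kl_integrand_compensation:
  fixes P :: "'a pmf"
  assumes b: "b > 1" and a: "\<And>x. 0 \<le> a x" "\<And>x. a x \<le> B" and c: "c \<ge> 0"
  defines "q \<equiv> measure_pmf.expectation P a"
  shows "(\<integral>\<^sup>+x. kl_integrand b (a x) c \<partial>P) =
    (\<integral>\<^sup>+x. kl_integrand b (a x) q \<partial>P) + kl_integrand b q c"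
proof -
  have int: "integrable P a"
    using a by (intro measure_pmf.integrable_const_bound[where B=B]) auto
  have q: "q \<ge> 0"
    unfolding q_def using a by (intro integral_nonneg_AE) auto
  have AE0: "AE x in P. a x = 0" if "q = 0"
    using that integral_nonneg_eq_0_iff_AE[OF int] a by (simp add: q_def)
  consider "q = 0" | "q > 0" "c = 0" | "q > 0" "c > 0"
    using q c by force
  then show ?thesis
  proof cases
    case 1
    have "(\<integral>\<^sup>+x. kl_integrand b (a x) s \<partial>P) = kl_integrand b 0 s" for s
    proof -
      have "(\<integral>\<^sup>+x. kl_integrand b (a x) s \<partial>P) = (\<integral>\<^sup>+x. kl_integrand b 0 s \<partial>P)"
        using AE0[OF 1] by (intro nn_integral_cong_AE) auto
      then show ?thesis
        by simp
    qed
    then show ?thesis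
      by (simp add: 1) (simp add: kl_integrand_def)
  next
    case 2
    \<comment> \<open>Both sides are infinite: on the left through a point of positive mass where
      \<open>a\<close> is nonzero, on the right through \<open>kl_integrand b q 0\<close>.\<close>
    have "\<not> (AE x in P. a x = 0)"
    proof
      assume "AE x in P. a x = 0"
      then have "q = 0"
        unfolding q_def by (rule integral_eq_zero_AE)
      then show False
        using 2 by simp
    qed
    then obtain x where x: "x \<in> set_pmf P" "a x \<noteq> 0"
      by (auto simp: AE_measure_pmf_iff)
    then have "ennreal (pmf P x) * kl_integrand b (a x) c = \<infinity>"
      using 2 by (simp add: kl_integrand_def ennreal_mult_top set_pmf_iff)
    then have "(\<integral>\<^sup>+x. kl_integrand b (a x) c \<partial>P) = \<infinity>"
      using nn_integral_ge_point[of x UNIV "\<lambda>x. ennreal (pmf P x) * kl_integrand b (a x) c"]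
      by (simp add: nn_integral_measure_pmf top_unique)
    then show ?thesis
      using 2 by (simp add: kl_integrand_def)
  next
    case 3
    \<comment> \<open>\<open>l\<close> has no definite sign; the shift by \<open>M\<close> keeps all integrands nonnegative.\<close>
    define l where "l x = a x * log b (q / c) - (q - c) / ln b" for x
    define M where "M = \<bar>B * log b (q / c)\<bar> + \<bar>(q - c) / ln b\<bar>"
    have M: "l x + M \<ge> 0" for x
    proof -
      have "\<bar>a x * log b (q / c)\<bar> \<le> \<bar>B * log b (q / c)\<bar>"
        using a(1)[of x] a(2)[of x] by (auto simp: abs_mult intro!: mult_right_mono)
      then show ?thesis
        unfolding l_def M_def by linarith
    qed
    have M0: "M \<ge> 0"
      by (simp add: M_def)
    have split: "kl_integrand b (a x) c + ennreal M = kl_integrand b (a x) q + ennreal (l x + M)" for x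
    proof -
      \<comment> \<open>Splitting the logarithm of \<open>a x / c\<close> at \<open>q\<close> needs
        \<open>a x > 0\<close>; at 0 the factor \<open>a x\<close> removes the logarithms.\<close>
      have "a x * log b (a x / c) - (a x - c) / ln b + M =
          a x * log b (a x / q) - (a x - q) / ln b + (l x + M)"
        using 3 a(1)[of x]
        by (cases "a x = 0") (auto simp: l_def log_divide diff_divide_distrib algebra_simps less_le)
      then show ?thesis
        using 3 a(1)[of x] M[of x] M0 kl_integrand_nonneg[OF b, of "a x" c]
          kl_integrand_nonneg[OF b, of "a x" q]
        by (simp add: kl_integrand_def flip: ennreal_plus)
    qed
    have "(\<integral>\<^sup>+x. ennreal (l x + M) \<partial>P) = ennreal (measure_pmf.expectation P (\<lambda>x. l x + M))"
      using M int by (intro nn_integral_eq_integral) (auto simp: l_def[abs_def])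
    also have "measure_pmf.expectation P (\<lambda>x. l x + M) = q * log b (q / c) - (q - c) / ln b + M"
      using int by (simp add: l_def[abs_def] q_def)
    also have "ennreal \<dots> = kl_integrand b q c + ennreal M"
      using 3 M0 kl_integrand_nonneg[OF b, of q c] by (simp add: kl_integrand_def flip: ennreal_plus)
    finally have l: "(\<integral>\<^sup>+x. ennreal (l x + M) \<partial>P) = kl_integrand b q c + ennreal M" .
    have "(\<integral>\<^sup>+x. kl_integrand b (a x) c \<partial>P) + ennreal M =
        (\<integral>\<^sup>+x. kl_integrand b (a x) c + ennreal M \<partial>P)"
      by (simp add: nn_integral_add)
    also have "\<dots> = (\<integral>\<^sup>+x. kl_integrand b (a x) q \<partial>P) + (kl_integrand b q c + ennreal M)"
      by (simp add: split nn_integral_add l)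
    \<comment> \<open>\<open>ennreal M\<close> is finite and may be cancelled even if the integrals
      are infinite.\<close>
    finally show ?thesis
      by (simp add: add.assoc[symmetric])
  qed
qed

theorem proposition1:
  fixes b :: real
    and W :: "'x::countable \<Rightarrow> 'y::countable pmf"
    and P :: "'x pmf"
  assumes "b > 1"
  shows "skl_info b P W =
    (\<Sum>\<^sub>\<infinity>x. \<Sum>\<^sub>\<infinity>x'. ereal (pmf P x) * ereal (pmf P x') * kl_div b (W x) (W x'))"
proof -
  define \<phi> where "\<phi> = kl_integrand b"
  define q where "q = pmf (output_pmf P W)"
  let ?D = "\<lambda>x x'. \<integral>\<^sup>+y. \<phi> (pmf (W x) y) (pmf (W x') y) \<partial>count_space UNIV"
  have swap: "(\<integral>\<^sup>+x. \<integral>\<^sup>+y. g x y \<partial>count_space UNIV \<partial>P) =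
      (\<integral>\<^sup>+y. \<integral>\<^sup>+x. g x y \<partial>P \<partial>count_space UNIV)" for g :: "'x \<Rightarrow> 'y \<Rightarrow> ennreal"
    by (rule nn_integral_count_space_nn_integral) auto
  have compensation: "(\<integral>\<^sup>+x. \<phi> (pmf (W x) y) c \<partial>P) =
      (\<integral>\<^sup>+x. \<phi> (pmf (W x) y) (q y) \<partial>P) + \<phi> (q y) c" if "c \<ge> 0" for y c
    using nn_integral_kl_integrand_compensation[OF assms, of "\<lambda>x. pmf (W x) y" 1 c P] that
    by (simp add: \<phi>_def q_def output_pmf_def pmf_bind pmf_le_1)
  have product: "(\<integral>\<^sup>+(x, y). ennreal (pmf P x) * g x y \<partial>count_space UNIV) =
      (\<integral>\<^sup>+y. \<integral>\<^sup>+x. g x y \<partial>P \<partial>count_space UNIV)" for g :: "'x \<Rightarrow> 'y \<Rightarrow> ennreal"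
  proof -
    have "(\<integral>\<^sup>+(x, y). ennreal (pmf P x) * g x y \<partial>count_space UNIV) =
        (\<integral>\<^sup>+x. \<integral>\<^sup>+y. ennreal (pmf P x) * g x y \<partial>count_space UNIV \<partial>count_space UNIV)"
      by (simp add: nn_integral_fst_count_space[symmetric])
    also have "\<dots> = (\<integral>\<^sup>+x. \<integral>\<^sup>+y. g x y \<partial>count_space UNIV \<partial>P)"
      by (simp add: nn_integral_cmult nn_integral_measure_pmf)
    finally show ?thesis
      by (simp only: swap)
  qed
  \<comment> \<open>At \<open>(x, y)\<close> the joint and the product probability share the factor
    \<open>pmf P x\<close>, which homogeneity pulls out; the same happens for the Lautum
    information.\<close>
  have "mutual_info b P W =
      enn2ereal (\<integral>\<^sup>+(x, y). ennreal (pmf P x) * \<phi> (pmf (W x) y) (q y) \<partial>count_space UNIV)"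
    unfolding mutual_info_def kl_div_eq_nn_integral[OF assms]
    by (auto intro!: arg_cong[of _ _ enn2ereal] nn_integral_cong
        simp: pmf_joint_pmf pmf_pair kl_integrand_cmult \<phi>_def q_def)
  then have mutual: "mutual_info b P W =
      enn2ereal (\<integral>\<^sup>+y. \<integral>\<^sup>+x. \<phi> (pmf (W x) y) (q y) \<partial>P \<partial>count_space UNIV)"
    by (simp only: product)
  have "lautum_info b P W =
      enn2ereal (\<integral>\<^sup>+(x, y). ennreal (pmf P x) * \<phi> (q y) (pmf (W x) y) \<partial>count_space UNIV)"
    unfolding lautum_info_def kl_div_eq_nn_integral[OF assms]
    by (auto intro!: arg_cong[of _ _ enn2ereal] nn_integral_cong
        simp: pmf_joint_pmf pmf_pair kl_integrand_cmult \<phi>_def q_def)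
  then have lautum: "lautum_info b P W =
      enn2ereal (\<integral>\<^sup>+y. \<integral>\<^sup>+x. \<phi> (q y) (pmf (W x) y) \<partial>P \<partial>count_space UNIV)"
    by (simp only: product)
  have "(\<integral>\<^sup>+x. \<integral>\<^sup>+x'. ?D x x' \<partial>P \<partial>P) =
      (\<integral>\<^sup>+y. \<integral>\<^sup>+x. \<integral>\<^sup>+x'. \<phi> (pmf (W x) y) (pmf (W x') y) \<partial>P \<partial>P \<partial>count_space UNIV)"
    by (simp add: swap)
  \<comment> \<open>The input letters are exchanged so that the inner integral averages the first
    argument of \<open>\<phi>\<close>, as \<open>compensation\<close> requires.\<close>
  also have "\<dots> = (\<integral>\<^sup>+y. \<integral>\<^sup>+x'. \<integral>\<^sup>+x. \<phi> (pmf (W x) y) (pmf (W x') y) \<partial>P \<partial>P \<partial>count_space UNIV)"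
    by (subst (1 2) nn_integral_measure_pmf)
       (simp add: nn_integral_count_space_nn_integral nn_integral_cmult)
  \<comment> \<open>\<open>compensation\<close> is used with \<open>c = pmf (W x') y\<close>; its
    first term does not depend on \<open>x'\<close>, and \<open>P\<close> has total mass 1.\<close>
  also have "\<dots> = (\<integral>\<^sup>+y. (\<integral>\<^sup>+x. \<phi> (pmf (W x) y) (q y) \<partial>P) +
      (\<integral>\<^sup>+x'. \<phi> (q y) (pmf (W x') y) \<partial>P) \<partial>count_space UNIV)"
    by (simp add: compensation nn_integral_add)
  also have "enn2ereal \<dots> = skl_info b P W"
    by (simp add: nn_integral_add skl_info_def mutual lautum plus_ennreal.rep_eq)
  finally have "skl_info b P W = enn2ereal (\<integral>\<^sup>+x. \<integral>\<^sup>+x'. ?D x x' \<partial>P \<partial>P)"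
    by simp
  also have "(\<integral>\<^sup>+x. \<integral>\<^sup>+x'. ?D x x' \<partial>P \<partial>P) =
      (\<integral>\<^sup>+x. \<integral>\<^sup>+x'. ennreal (pmf P x) * ennreal (pmf P x') * ?D x x'
        \<partial>count_space UNIV \<partial>count_space UNIV)"
    by (simp add: nn_integral_measure_pmf nn_integral_cmult mult.assoc)
  also have "enn2ereal \<dots> =
      (\<Sum>\<^sub>\<infinity>x. \<Sum>\<^sub>\<infinity>x'. enn2ereal (ennreal (pmf P x) * ennreal (pmf P x') * ?D x x'))"
    by (simp only: infsum_enn2ereal)
  also have "\<dots> = (\<Sum>\<^sub>\<infinity>x. \<Sum>\<^sub>\<infinity>x'. ereal (pmf P x) * ereal (pmf P x') * kl_div b (W x) (W x'))"
    by (simp add: times_ennreal.rep_eq enn2ereal_ennreal kl_div_eq_nn_integral[OF assms] \<phi>_def)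
  finally show ?thesis .
qed

end
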